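(* Consider the finite volume scheme described in the context. If the boundary values $W_0^n,W_{N+1}^n$ ($n=1,2,\ldots,L$) and the initial values $W_i^0$ ($i=1,2,\ldots,N$) are all nonnegative, then the scheme generates nonnegative solutions: $W_i^n\ge0$ for all $i=1,\ldots,N$ and $n=1,\ldots,L$.
   Context: Let $a<b$, $T>0$, $\alpha\in(0,1)$, $k_\alpha>0$ be real constants, and let $f:[a,b]\to\mathbb{R}$ be Lipschitz: $|f(x)-f(x')|\le C|x-x'|$ for all $x,x'\in[a,b]$. For positive integers $N,L$ put $h=(b-a)/(N+1)$, $x_i=a+ih$ ($i=0,\ldots,N+1$), $x_{i+\frac12}=a+(i+\frac12)h$ ($i=0,\ldots,N$), $\Delta t=T/L$, $t_k=k\Delta t$ ($k=0,\ldots,L$). $\Gamma$ is the gamma function and $a_k=(k+1)^{1-\alpha}-k^{1-\alpha}$ for $k=0,1,2,\ldots$. Decompose $f=f^u+f^l+f^m$ with $f^u(x)=\max(f(x)-\frac{2k_\alpha}{h},0)$, $f^l(x)=\min(f(x)+\frac{2k_\alpha}{h},0)$, $f^m=f-f^u-f^l$. A subscript $i+\frac12$ denotes evaluation at $x_{i+\frac12}$. Finite volume scheme: for grid values $W_i^n$ ($0\le i\le N+1$, $1\le n\le L$) set, for $i=0,\ldots,N$, $$\widehat{\left(\tfrac{\partial W}{\partial x}\right)}_{i+\frac12,n}=\frac{W_{i+1}^n-W_i^n}{h},\qquad \widetilde{(fW)}_{i+\frac12,n}=f^m_{i+\frac12}\frac{W_i^n+W_{i+1}^n}{2}+f^u_{i+\frac12}W_i^n+f^l_{i+\frac12}W_{i+1}^n.$$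 The scheme requires, for $i=1,\ldots,N$ and $n=1,\ldots,L$, $$\frac{h\Delta t^{-\alpha}}{\Gamma(2-\alpha)}\left(W_i^n-\sum_{k=1}^{n-1}(a_{n-k-1}-a_{n-k})W_i^k-a_{n-1}W_i^0\right)=k_\alpha\left(\widehat{\left(\tfrac{\partial W}{\partial x}\right)}_{i+\frac12,n}-\widehat{\left(\tfrac{\partial W}{\partial x}\right)}_{i-\frac12,n}\right)-\left(\widetilde{(fW)}_{i+\frac12,n}-\widetilde{(fW)}_{i-\frac12,n}\right),$$ with prescribed boundary values $W_0^n=g_1(t_n)$, $W_{N+1}^n=g_2(t_n)$ for $n=1,\ldots,L$ and given initial values $W_i^0$, $i=1,\ldots,N$. *)

theory Defs
  imports "HOL-Analysis.Analysis"
begin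

definition mesh_size :: "real \<Rightarrow> real \<Rightarrow> nat \<Rightarrow> real" where
  "mesh_size a b N = (b - a) / (real N + 1)"

definition time_step :: "real \<Rightarrow> nat \<Rightarrow> real" where
  "time_step T L = T / real L"

definition time_node :: "real \<Rightarrow> nat \<Rightarrow> nat \<Rightarrow> real" where
  "time_node T L k = real k * time_step T L"

text \<open>Interfaces and the quantities living on them are indexed by the integer to their left:
  index \<open>i\<close> stands for \<open>i + 1/2\<close>, so \<open>i - 1/2\<close> (with \<open>i \<ge> 1\<close>) is written as index \<open>i - 1\<close>.\<close>

definition half_node :: "real \<Rightarrow> real \<Rightarrow> nat \<Rightarrow> nat \<Rightarrow> real" where
  "half_node a b N i = a + (real i + 1/2) * mesh_size a b N"

text \<open>Since \<open>0 powr s = 0\<close>, this gives \<open>L1_weight \<alpha> 0 = 1\<close> for \<open>\<alpha> < 1\<close>, as it should.\<close>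

definition L1_weight :: "real \<Rightarrow> nat \<Rightarrow> real" where
  "L1_weight \<alpha> k = (real k + 1) powr (1 - \<alpha>) - real k powr (1 - \<alpha>)"

definition upper_part :: "real \<Rightarrow> real \<Rightarrow> (real \<Rightarrow> real) \<Rightarrow> real \<Rightarrow> real" where
  "upper_part k\<alpha> h f x = max (f x - 2 * k\<alpha> / h) 0"

definition lower_part :: "real \<Rightarrow> real \<Rightarrow> (real \<Rightarrow> real) \<Rightarrow> real \<Rightarrow> real" where
  "lower_part k\<alpha> h f x = min (f x + 2 * k\<alpha> / h) 0"

definition middle_part :: "real \<Rightarrow> real \<Rightarrow> (real \<Rightarrow> real) \<Rightarrow> real \<Rightarrow> real" where
  "middle_part k\<alpha> h f x = f x - upper_part k\<alpha> h f x - lower_part k\<alpha> h f x"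

text \<open>Grid values are written \<open>W i n\<close>, with space index \<open>i\<close> and time index \<open>n\<close>.\<close>

definition diff_flux ::
  "real \<Rightarrow> real \<Rightarrow> nat \<Rightarrow> (nat \<Rightarrow> nat \<Rightarrow> real) \<Rightarrow> nat \<Rightarrow> nat \<Rightarrow> real" where
  "diff_flux a b N W i n = (W (i + 1) n - W i n) / mesh_size a b N"

definition adv_flux ::
  "real \<Rightarrow> real \<Rightarrow> nat \<Rightarrow> real \<Rightarrow> (real \<Rightarrow> real) \<Rightarrow> (nat \<Rightarrow> nat \<Rightarrow> real) \<Rightarrow> nat \<Rightarrow> nat \<Rightarrow> real" where
  "adv_flux a b N k\<alpha> f W i n =
     (let h = mesh_size a b N; x = half_node a b N i in
        middle_part k\<alpha> h f x * ((W i n + W (i + 1) n) / 2)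
        + upper_part k\<alpha> h f x * W i n
        + lower_part k\<alpha> h f x * W (i + 1) n)"

definition fv_equation ::
  "real \<Rightarrow> real \<Rightarrow> real \<Rightarrow> nat \<Rightarrow> nat \<Rightarrow> real \<Rightarrow> real \<Rightarrow> (real \<Rightarrow> real)
    \<Rightarrow> (nat \<Rightarrow> nat \<Rightarrow> real) \<Rightarrow> nat \<Rightarrow> nat \<Rightarrow> bool" where
  "fv_equation a b T N L \<alpha> k\<alpha> f W i n \<longleftrightarrow>
     mesh_size a b N * time_step T L powr (- \<alpha>) / Gamma (2 - \<alpha>) *
       (W i n
        - (\<Sum>k = 1..n - 1. (L1_weight \<alpha> (n - k - 1) - L1_weight \<alpha> (n - k)) * W i k)
        - L1_weight \<alpha> (n - 1) * W i 0)
     = k\<alpha> * (diff_flux a b N W i n - diff_flux a b N W (i - 1) n)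
       - (adv_flux a b N k\<alpha> f W i n - adv_flux a b N k\<alpha> f W (i - 1) n)"

text \<open>The initial values are the entries \<open>W i 0\<close> for \<open>1 \<le> i \<le> N\<close>; they are unconstrained here.
  The corner values \<open>W 0 0\<close> and \<open>W (N + 1) 0\<close> do not enter the scheme.\<close>

definition fv_solution ::
  "real \<Rightarrow> real \<Rightarrow> real \<Rightarrow> nat \<Rightarrow> nat \<Rightarrow> real \<Rightarrow> real \<Rightarrow> (real \<Rightarrow> real)
    \<Rightarrow> (real \<Rightarrow> real) \<Rightarrow> (real \<Rightarrow> real) \<Rightarrow> (nat \<Rightarrow> nat \<Rightarrow> real) \<Rightarrow> bool" where
  "fv_solution a b T N L \<alpha> k\<alpha> f g1 g2 W \<longleftrightarrow>
     (\<forall>i\<in>{1..N}. \<forall>n\<in>{1..L}. fv_equation a b T N L \<alpha> k\<alpha> f W i n) \<and>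
     (\<forall>n\<in>{1..L}. W 0 n = g1 (time_node T L n) \<and> W (N + 1) n = g2 (time_node T L n))"

end

theory Submission
  imports Defs
begin

text \<open>Each interface flux has the form \<open>p\<^sub>i W\<^sub>i - q\<^sub>i W\<^sub>i\<^sub>+\<^sub>1\<close> with \<open>p\<^sub>i, q\<^sub>i \<ge> 0\<close>, because the splitting
  of \<open>f\<close> keeps \<open>f\<^sup>m\<close> within \<open>[-2 k\<^sub>\<alpha> / h, 2 k\<^sub>\<alpha> / h]\<close>. The negative part \<open>min (W\<^sub>i) 0\<close> is then a
  supersolution of the scheme at each time level; summing over the interior nodes, the fluxes
  telescope to a nonpositive boundary term, so the negative part vanishes. The L1 weights are
  nonnegative and decreasing, so the memory term is nonnegative by induction on the time level.\<close>

text \<open>The increment \<open>(y + 1) powr s - y powr s\<close> has derivative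
  \<open>s * ((y + 1) powr (s - 1) - y powr (s - 1))\<close>, which is nonpositive since
  \<open>s - 1 \<le> 0\<close>. At \<open>x = 0\<close> differentiability may fail, and the claim
  reduces to \<open>2 powr s \<le> 2\<close>.\<close>

lemma powr_second_difference_nonpos:
  fixes x s :: real
  assumes "0 \<le> x" and "0 \<le> s" and "s \<le> 1"
  shows "(x + 2) powr s - (x + 1) powr s \<le> (x + 1) powr s - x powr s"
proof (cases "x = 0")
  case True
  have "2 powr s \<le> (2::real) powr 1"
    using assms by (intro powr_mono) auto
  then show ?thesis using True by simp
next
  case False
  have "\<exists>d. ((\<lambda>y. (y + 1) powr s - y powr s) has_real_derivative d) (at y) \<and> d \<le> 0"
    if "x \<le> y" for y
  proof -
    have "y > 0" using False assms that by simp
    then have "((\<lambda>y. (y + 1) powr s - y powr s) has_real_derivative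
        s * (y + 1) powr (s - 1) - s * y powr (s - 1)) (at y)"
      by (auto intro!: derivative_eq_intros)
    moreover have "(y + 1) powr (s - 1) \<le> y powr (s - 1)"
      using \<open>y > 0\<close> assms by (intro powr_mono2') auto
    then have "s * (y + 1) powr (s - 1) - s * y powr (s - 1) \<le> 0"
      using assms by (simp add: mult_left_mono)
    ultimately show ?thesis by blast
  qed
  then have "(x + 1 + 1) powr s - (x + 1) powr s \<le> (x + 1) powr s - x powr s"
    using DERIV_nonpos_imp_nonincreasing[of x "x + 1" "\<lambda>y. (y + 1) powr s - y powr s"] by auto
  then show ?thesis by (simp add: add.assoc)
qed

lemma L1_weight_nonneg: "\<alpha> \<le> 1 \<Longrightarrow> 0 \<le> L1_weight \<alpha> k"
  by (simp add: L1_weight_def powr_mono2)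

lemma L1_weight_Suc_le:
  assumes "0 \<le> \<alpha>" and "\<alpha> \<le> 1"
  shows "L1_weight \<alpha> (Suc k) \<le> L1_weight \<alpha> k"
  using powr_second_difference_nonpos[of "real k" "1 - \<alpha>"] assms
  by (simp add: L1_weight_def add.commute)

text \<open>One time level of the scheme, with the history in \<open>r\<close>. Each
  \<open>p j\<close> and \<open>q j\<close> enters two neighbouring equations with opposite signs,
  so the matrix is diagonally dominant by columns; by rows this can fail. Hence the equations are
  summed rather than examined at a minimum of \<open>w\<close>.\<close>

lemma discrete_maximum_principle:
  fixes p q w r :: "nat \<Rightarrow> real" and c :: real
  assumes c: "c > 0"
    and p: "\<And>i. p i \<ge> 0" and q: "\<And>i. q i \<ge> 0" and r: "\<And>i. i \<in> {1..N} \<Longrightarrow> r i \<ge> 0"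
    and eq: "\<And>i. i \<in> {1..N} \<Longrightarrow>
      c * w i + (p i * w i - q i * w (i + 1)) - (p (i - 1) * w (i - 1) - q (i - 1) * w i) = r i"
    and left: "w 0 \<ge> 0" and right: "w (N + 1) \<ge> 0"
    and i: "i \<in> {1..N}"
  shows "w i \<ge> 0"
proof -
  define v where "v j = min (w j) 0" for j
  define H where "H j = p j * v j - q j * v (j + 1)" for j
  have v: "v j \<le> 0" "v j \<le> w j" for j
    by (auto simp: v_def)
  have super: "0 \<le> c * v j + (H j - H (j - 1))" if j: "j \<in> {1..N}" for j
  proof (cases "w j < 0")
    case True
    then have "v j = w j" by (simp add: v_def)
    \<comment> \<open>Replacing the neighbours of \<open>w j\<close> by their negative parts only
      lowers the subtracted terms, so the left-hand side stays above \<open>r j\<close>.\<close>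
    moreover have "q j * v (j + 1) \<le> q j * w (j + 1)" "p (j - 1) * v (j - 1) \<le> p (j - 1) * w (j - 1)"
      using v p q by (auto intro: mult_left_mono)
    ultimately show ?thesis
      using eq[OF j] r[OF j] j by (simp add: H_def)
  next
    case False
    then have "v j = 0" by (simp add: v_def)
    then show ?thesis
      using j v p q mult_nonneg_nonpos[of "q j" "v (j + 1)"]
        mult_nonneg_nonpos[of "p (j - 1)" "v (j - 1)"] by (simp add: H_def)
  qed
  have "0 \<le> (\<Sum>j = 1..N. c * v j + (H j - H (j - 1)))"
    using super by (rule sum_nonneg)
  also have "\<dots> = c * (\<Sum>j = 1..N. v j) + (H N - H 0)"
    using sum_telescope''[of 0 N H] by (simp add: sum.distrib sum_distrib_left)
  also have "\<dots> \<le> c * (\<Sum>j = 1..N. v j)"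
  proof -
    \<comment> \<open>Hence \<open>H N = p N * v N \<le> 0\<close> and
      \<open>H 0 = - q 0 * v 1 \<ge> 0\<close>.\<close>
    have "v 0 = 0" "v (N + 1) = 0" using left right by (auto simp: v_def)
    then show ?thesis
      using v p q mult_nonneg_nonpos[of "p N" "v N"] mult_nonneg_nonpos[of "q 0" "v 1"]
      by (simp add: H_def)
  qed
  finally have "0 \<le> (\<Sum>j = 1..N. v j)"
    using c by (simp add: zero_le_mult_iff)
  \<comment> \<open>All summands are nonpositive, so the sum lies below each of them.\<close>
  also have "\<dots> \<le> v i"
    using i v sum.remove[of "{1..N}" i v] sum_nonpos[of "{1..N} - {i}" v] by simp
  finally show ?thesis by (simp add: v_def)
qed

text \<open>Half the middle part is at most \<open>k\<alpha> / h\<close> in absolute value, so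
  diffusion absorbs the centred flux, while the upwind parts have the signs that only increase
  \<open>p\<close> and \<open>q\<close>.\<close>

lemma adv_minus_diff_flux:
  fixes a b k\<alpha> :: real
  assumes "a < b" and "k\<alpha> > 0"
  obtains p q :: "nat \<Rightarrow> real" where "\<And>i. p i \<ge> 0" and "\<And>i. q i \<ge> 0"
    and "\<And>W i n. adv_flux a b N k\<alpha> f W i n - k\<alpha> * diff_flux a b N W i n
      = p i * W i n - q i * W (i + 1) n"
proof -
  define h where "h = mesh_size a b N"
  define x where "x = half_node a b N"
  define p where "p i = middle_part k\<alpha> h f (x i) / 2 + upper_part k\<alpha> h f (x i) + k\<alpha> / h" for i
  define q where "q i = k\<alpha> / h - middle_part k\<alpha> h f (x i) / 2 - lower_part k\<alpha> h f (x i)" for i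
  have "h > 0"
    using assms by (simp add: h_def mesh_size_def)
  \<comment> \<open>Naming the quotient makes the sign checks below linear in \<open>d\<close> and
    the value of \<open>f\<close>.\<close>
  then obtain d where d: "k\<alpha> / h = d" "2 * k\<alpha> / h = 2 * d" "d > 0"
    using assms by (auto intro: that[of "k\<alpha> / h"])
  have "p i \<ge> 0" "q i \<ge> 0" for i
    unfolding p_def q_def middle_part_def upper_part_def lower_part_def d(1,2)
    using d(3) by (auto simp: max_def min_def)
  moreover have "adv_flux a b N k\<alpha> f W i n - k\<alpha> * diff_flux a b N W i n
      = p i * W i n - q i * W (i + 1) n" for W i n
    by (simp add: adv_flux_def diff_flux_def Let_def p_def q_def algebra_simps
        add_divide_distrib diff_divide_distrib flip: h_def x_def)
  ultimately show thesis by (rule that)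
qed

theorem mainTheorem3:
  fixes a b T \<alpha> k\<alpha> C :: real and N L :: nat
    and f g1 g2 :: "real \<Rightarrow> real" and W :: "nat \<Rightarrow> nat \<Rightarrow> real"
  assumes "a < b" and "T > 0" and "0 < \<alpha>" and "\<alpha> < 1" and "k\<alpha> > 0"
    and "N \<ge> 1" and "L \<ge> 1"
    and "C-lipschitz_on {a..b} f"
    and "fv_solution a b T N L \<alpha> k\<alpha> f g1 g2 W"
    and "\<And>n. n \<in> {1..L} \<Longrightarrow> W 0 n \<ge> 0"
    and "\<And>n. n \<in> {1..L} \<Longrightarrow> W (N + 1) n \<ge> 0"
    and "\<And>i. i \<in> {1..N} \<Longrightarrow> W i 0 \<ge> 0"
  shows "\<forall>i\<in>{1..N}. \<forall>n\<in>{1..L}. W i n \<ge> 0"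
proof -
  obtain p q where p: "\<And>i. p i \<ge> 0" and q: "\<And>i. q i \<ge> 0"
    and flux: "\<And>W i n. adv_flux a b N k\<alpha> f W i n - k\<alpha> * diff_flux a b N W i n
      = p i * W i n - q i * W (i + 1) n"
    using adv_minus_diff_flux[OF \<open>a < b\<close> \<open>k\<alpha> > 0\<close>] by metis
  define c where "c = mesh_size a b N * time_step T L powr (- \<alpha>) / Gamma (2 - \<alpha>)"
  have "mesh_size a b N > 0" "time_step T L > 0" "Gamma (2 - \<alpha>) > 0"
    using assms(1-7) by (auto simp: mesh_size_def time_step_def intro: Gamma_real_pos)
  then have c: "c > 0" by (simp add: c_def)
  define R where "R i n =
    (\<Sum>k = 1..n - 1. (L1_weight \<alpha> (n - k - 1) - L1_weight \<alpha> (n - k)) * W i k)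
      + L1_weight \<alpha> (n - 1) * W i 0" for i n
  have eq: "c * W i n + (p i * W i n - q i * W (i + 1) n)
      - (p (i - 1) * W (i - 1) n - q (i - 1) * W i n) = c * R i n"
    if "i \<in> {1..N}" "n \<in> {1..L}" for i n
  proof -
    have "c * (W i n - R i n)
      = k\<alpha> * (diff_flux a b N W i n - diff_flux a b N W (i - 1) n)
        - (adv_flux a b N k\<alpha> f W i n - adv_flux a b N k\<alpha> f W (i - 1) n)"
      using assms(9) that
      by (simp add: fv_solution_def fv_equation_def c_def R_def diff_diff_eq)
    then show ?thesis
      using flux[of W i n] flux[of W "i - 1" n] that(1) by (simp add: algebra_simps)
  qed
  have "\<forall>i\<in>{1..N}. W i n \<ge> 0" if "n \<le> L" for n
    using that
  proof (induction n rule: less_induct)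
    case (less n)
    show ?case
    proof (cases "n = 0")
      case True
      then show ?thesis using assms(12) by simp
    next
      case False
      then have n: "n \<in> {1..L}" using less.prems by simp
      have R: "0 \<le> c * R i n" if i: "i \<in> {1..N}" for i
      proof -
        have "L1_weight \<alpha> (n - k) \<le> L1_weight \<alpha> (n - k - 1)" if "k \<in> {1..n - 1}" for k
        proof -
          \<comment> \<open>Here \<open>k < n\<close>, so the truncated subtraction is
            exact.\<close>
          have "n - k = Suc (n - k - 1)" using that by auto
          then show ?thesis
            using L1_weight_Suc_le[of \<alpha> "n - k - 1"] assms(3,4) by simp
        qed
        moreover have "W i k \<ge> 0" if "k \<in> {1..n - 1}" for k
          using less.IH[of k] less.prems i that by auto
        moreover have "L1_weight \<alpha> (n - 1) \<ge> 0" using assms(4) by (simp add: L1_weight_nonneg)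
        ultimately have "R i n \<ge> 0"
          unfolding R_def using assms(12)[OF i]
          by (intro add_nonneg_nonneg sum_nonneg mult_nonneg_nonneg) auto
        then show ?thesis using c by simp
      qed
      show ?thesis
        using discrete_maximum_principle[where w = "\<lambda>i. W i n", OF c p q R eq] n assms(10,11)
        by blast
    qed
  qed
  then show ?thesis by auto
qed

end
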